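(* $${}_2F_1\left(\tfrac13,\tfrac23;\tfrac76;\tfrac5{32}\right)=\frac1{20}\,\frac{\sqrt3\,\Gamma(1/3)^6}{\pi^3}.$$
   Context: For complex $a,b,c$ with $c\notin\{0,-1,-2,\dots\}$ and $|x|<1$, ${}_2F_1(a,b;c;x)=\sum_{n\ge 0}\frac{(a,n)(b,n)}{(c,n)(1,n)}x^n$ denotes Gauss's hypergeometric series, where $(\alpha,n)=\alpha(\alpha+1)\cdots(\alpha+n-1)$, $(\alpha,0)=1$. *)

theory Defs
  imports "HOL-Analysis.Analysis"
begin

text \<open>
  Gauss's hypergeometric series. It is meaningful only for \<open>c\<close> not in \<open>{0, -1, -2, \<dots>}\<close>
  and \<open>norm x < 1\<close>, where the series converges; outside this range the value is junk
  (division by zero, or \<^const>\<open>suminf\<close> of a divergent series).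
\<close>

definition hyp2F1 :: "complex \<Rightarrow> complex \<Rightarrow> complex \<Rightarrow> complex \<Rightarrow> complex" where
  "hyp2F1 a b c x =
     (\<Sum>n. (pochhammer a n * pochhammer b n) / (pochhammer c n * pochhammer 1 n) * x ^ n)"

end

theory Submission
  imports Defs
begin

text \<open>
  By Euler's integral the value in question is, up to a Beta function, the period
  \<open>\<integral> t^(-1/3) (1 - t)^(-1/2) (1 - 5t/32)^(-1/3) dt\<close> over \<open>[0, 1]\<close>. For the parameter \<open>5/32\<close> the differential
  is the pullback of \<open>s^(-2/3) (1 - s)^(-1/2) ds\<close>, which lives on an elliptic curve with complex
  multiplication by the third roots of unity, under the degree five map
  \<open>s = t\<^sup>2 (t + 80)\<^sup>3 / (32 - 5t)\<^sup>4\<close>. This map is ramified only over \<open>0, 1, \<infinity>\<close>, since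
  \<open>(32 - 5t)\<^sup>4 - t\<^sup>2 (t + 80)\<^sup>3 = (1 - t) (1024 + 192t - t\<^sup>2)\<^sup>2\<close>, and it increases from 0 to 1 on
  \<open>[0, 1]\<close>. So the period is a multiple of \<open>B(1/3, 1/2)\<close>.
\<close>

section \<open>Euler's integral for the hypergeometric series\<close>

lemma nn_integral_Beta_real:
  fixes a b :: real
  assumes "a > 0" "b > 0"
  shows "(\<integral>\<^sup>+t. ennreal (t powr (a - 1) * (1 - t) powr (b - 1)) * indicator {0..1} t \<partial>lborel)
    = ennreal (Beta a b)"
proof -
  have "(\<integral>\<^sup>+t. ennreal (indicator {0..1} t * (t powr (a - 1) * (1 - t) powr (b - 1))) \<partial>lborel)
      = ennreal (Beta a b)"
    by (rule nn_integral_has_integral_lebesgue[OF _ has_integral_Beta_real]) (use assms in auto)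
  then show ?thesis
    by (simp add: ennreal_mult' ennreal_indicator mult.commute)
qed

lemma Beta_plus_nat_left:
  fixes a b :: real
  assumes "a > 0" "b > 0"
  shows "Beta (a + real n) b = Beta a b * (pochhammer a n / pochhammer (a + b) n)"
proof -
  have "a \<notin> \<int>\<^sub>\<le>\<^sub>0" "a + b \<notin> \<int>\<^sub>\<le>\<^sub>0"
    using assms by (auto dest!: nonpos_Ints_nonpos)
  moreover have "Gamma a > 0" "Gamma (a + b) > 0" "Gamma (a + b + real n) > 0"
    using assms by (auto intro!: Gamma_real_pos)
  ultimately show ?thesis
    by (simp add: pochhammer_Gamma Beta_def field_simps)
qed

lemma one_minus_powr_sums:
  fixes a y :: real
  assumes "\<bar>y\<bar> < 1"
  shows "(\<lambda>n. pochhammer a n / fact n * y ^ n) sums ((1 - y) powr (- a))"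
proof -
  have "(\<lambda>n. ((- a) gchoose n) * (- y) ^ n) sums ((1 + - y) powr (- a))"
    using assms by (intro gen_binomial_real) auto
  moreover have "((- a) gchoose n) * (- y) ^ n = pochhammer a n / fact n * y ^ n" for n
    by (simp add: gbinomial_pochhammer power_minus[of y n])
  ultimately show ?thesis by simp
qed

text \<open>Expand \<open>(1 - x * t) powr (- a)\<close> by the binomial series and integrate term
  by term. The \<open>n\<close>-th term is a multiple of a Beta integral with first parameter
  \<open>b + n\<close>, and \<open>Beta_plus_nat_left\<close> turns it into the quotient of
  \<open>pochhammer b n\<close> by \<open>pochhammer c n\<close>. All terms are nonnegative, so in
  \<open>ennreal\<close> the interchange requires no prior convergence argument.\<close>

lemma Euler_integral_nn_integral:
  fixes a b c x :: real
  assumes "a > 0" "b > 0" "b < c" "0 \<le> x" "x < 1"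
  shows "(\<integral>\<^sup>+t. ennreal (t powr (b - 1) * (1 - t) powr (c - b - 1) * (1 - x * t) powr (- a))
                * indicator {0..1} t \<partial>lborel)
    = (\<Sum>n. ennreal (Beta b (c - b)
        * ((pochhammer a n * pochhammer b n) / (pochhammer c n * pochhammer 1 n) * x ^ n)))"
proof -
  let ?k = "\<lambda>n. pochhammer a n / fact n * x ^ n"
  let ?f = "\<lambda>n t. ennreal (?k n)
    * (ennreal (t powr (b + real n - 1) * (1 - t) powr (c - b - 1)) * indicator {0..1} t)"
  have k_nonneg: "?k n \<ge> 0" for n
    using assms by (simp add: pochhammer_nonneg)
  have expand: "ennreal (t powr (b - 1) * (1 - t) powr (c - b - 1) * (1 - x * t) powr (- a))
      * indicator {0..1} t = (\<Sum>n. ?f n t)" for t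
  proof (cases "t \<in> {0<..1}")
    case True
    have "x * t \<le> x * 1"
      using True assms by (intro mult_left_mono) auto
    then have "\<bar>x * t\<bar> < 1"
      using True assms by simp
    from one_minus_powr_sums[OF this, of a]
    have "(\<lambda>n. t powr (b - 1) * (1 - t) powr (c - b - 1) * (pochhammer a n / fact n * (x * t) ^ n))
        sums (t powr (b - 1) * (1 - t) powr (c - b - 1) * (1 - x * t) powr (- a))"
      by (rule sums_mult)
    moreover have "t powr (b - 1) * (1 - t) powr (c - b - 1) * (pochhammer a n / fact n * (x * t) ^ n)
        = ?k n * (t powr (b + real n - 1) * (1 - t) powr (c - b - 1))" for n
    proof -
      have "t powr (b + real n - 1) = t powr (b - 1) * t ^ n"
        using True by (simp add: powr_realpow[symmetric] powr_add[symmetric] algebra_simps)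
      then show ?thesis by (simp add: power_mult_distrib)
    qed
    ultimately have "(\<lambda>n. ?k n * (t powr (b + real n - 1) * (1 - t) powr (c - b - 1)))
        sums (t powr (b - 1) * (1 - t) powr (c - b - 1) * (1 - x * t) powr (- a))"
      by (simp only:)
    then have "(\<lambda>n. ennreal (?k n * (t powr (b + real n - 1) * (1 - t) powr (c - b - 1))))
        sums ennreal (t powr (b - 1) * (1 - t) powr (c - b - 1) * (1 - x * t) powr (- a))"
      by (subst sums_ennreal) (use k_nonneg in \<open>auto intro!: mult_nonneg_nonneg simp del: times_divide_eq_left\<close>)
    moreover have "ennreal (?k n * (t powr (b + real n - 1) * (1 - t) powr (c - b - 1))) = ?f n t" for n
      using True by (subst ennreal_mult'[OF k_nonneg]) simp
    ultimately show ?thesis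
      using True by (simp only: sums_iff) simp
  next
    case False
    \<comment> \<open>At \<open>t = 0\<close> both sides vanish because \<open>0 powr\<close>
      anything is \<open>0\<close>; elsewhere the indicator kills them.\<close>
    then have "t = 0 \<or> t \<notin> {0..1}" by auto
    then show ?thesis by auto
  qed
  have integral_f: "(\<integral>\<^sup>+t. ?f n t \<partial>lborel) = ennreal (Beta b (c - b)
      * ((pochhammer a n * pochhammer b n) / (pochhammer c n * pochhammer 1 n) * x ^ n))" for n
  proof -
    have "(\<integral>\<^sup>+t. ?f n t \<partial>lborel) = ennreal (?k n) * ennreal (Beta (b + real n) (c - b))"
      using assms by (simp add: nn_integral_cmult nn_integral_Beta_real)
    also have "\<dots> = ennreal (?k n * Beta (b + real n) (c - b))"
      by (rule ennreal_mult'[symmetric, OF k_nonneg])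
    finally show ?thesis
      using assms by (simp add: Beta_plus_nat_left pochhammer_fact mult_ac)
  qed
  have "(\<integral>\<^sup>+t. ennreal (t powr (b - 1) * (1 - t) powr (c - b - 1) * (1 - x * t) powr (- a))
      * indicator {0..1} t \<partial>lborel) = (\<integral>\<^sup>+t. (\<Sum>n. ?f n t) \<partial>lborel)"
    by (simp only: expand)
  also have "\<dots> = (\<Sum>n. \<integral>\<^sup>+t. ?f n t \<partial>lborel)"
    by (rule nn_integral_suminf) measurable
  finally show ?thesis
    by (simp only: integral_f)
qed

text \<open>A finite value of the integral also yields convergence: a series of nonnegative reals
  whose \<open>ennreal\<close> sum is the real number \<open>V\<close> sums to \<open>V\<close> in
  the reals. Its terms then carry over to the complex numbers one by one.\<close>

lemma hyp2F1_eq_if_Euler_integral: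
  fixes a b c x V :: real
  assumes "a > 0" "b > 0" "b < c" "0 \<le> x" "x < 1" "V \<ge> 0"
    and "(\<integral>\<^sup>+t. ennreal (t powr (b - 1) * (1 - t) powr (c - b - 1) * (1 - x * t) powr (- a))
                * indicator {0..1} t \<partial>lborel) = ennreal V"
  shows "hyp2F1 (of_real a) (of_real b) (of_real c) (of_real x)
    = of_real (V / Beta b (c - b))"
proof -
  let ?t = "\<lambda>n. (pochhammer a n * pochhammer b n) / (pochhammer c n * pochhammer 1 n) * x ^ n"
  have B: "Beta b (c - b) > 0"
    using assms by (auto simp: Beta_def intro!: divide_pos_pos mult_pos_pos Gamma_real_pos)
  have "(\<Sum>n. ennreal (Beta b (c - b) * ?t n)) = ennreal V"
    using Euler_integral_nn_integral[of a b c x] assms by simp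
  then have "(\<lambda>n. ennreal (Beta b (c - b) * ?t n)) sums ennreal V"
    by (simp add: sums_iff)
  moreover have "Beta b (c - b) * ?t n \<ge> 0" for n
    using assms B by (auto intro!: mult_nonneg_nonneg divide_nonneg_nonneg pochhammer_nonneg)
  ultimately have "(\<lambda>n. Beta b (c - b) * ?t n) sums V"
    using assms by (subst (asm) sums_ennreal) auto
  then have "?t sums (V / Beta b (c - b))"
    using B sums_divide[of "\<lambda>n. Beta b (c - b) * ?t n" V "Beta b (c - b)"] by simp
  then have "(\<lambda>n. complex_of_real (?t n)) sums of_real (V / Beta b (c - b))"
    by (simp only: sums_of_real_iff)
  moreover have "complex_of_real (?t n) = (pochhammer (of_real a) n * pochhammer (of_real b) n)
      / (pochhammer (of_real c) n * pochhammer 1 n) * of_real x ^ n" for n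
    using pochhammer_of_real[where 'a = complex, of 1 n] by (simp add: pochhammer_of_real)
  ultimately show ?thesis
    unfolding hyp2F1_def by (simp add: sums_iff)
qed

section \<open>The degree five substitution\<close>

definition quintic :: "real \<Rightarrow> real" where
  "quintic t = t ^ 2 * (t + 80) ^ 3 / (32 - 5 * t) ^ 4"

text \<open>The derivative of \<open>quintic\<close> in factored form. Its quadratic factor is the
  one that occurs squared in \<open>1 - quintic t\<close>, so its roots are the double points over
  1.\<close>

definition quintic' :: "real \<Rightarrow> real" where
  "quintic' t = 5 * (1024 + 192 * t - t ^ 2) * t * (t + 80) ^ 2 / (32 - 5 * t) ^ 5"

lemma one_minus_quintic:
  assumes "t \<le> 1"
  shows "1 - quintic t = (1 - t) * (1024 + 192 * t - t ^ 2) ^ 2 / (32 - 5 * t) ^ 4"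
proof -
  have "32 - 5 * t \<noteq> 0" using assms by auto
  moreover have "(32 - 5 * t) ^ 4 - t ^ 2 * (t + 80) ^ 3
      = (1 - t) * (1024 + 192 * t - t ^ 2) ^ 2"
    by algebra
  ultimately show ?thesis
    unfolding quintic_def by (simp add: field_simps)
qed

lemma quintic_has_derivative:
  assumes "t \<le> 1"
  shows "(quintic has_real_derivative quintic' t) (at t)"
proof -
  define u p where "u = 32 - 5 * t" and "p = t + 80"
  have nz: "u \<noteq> 0" using assms by (auto simp: u_def)
  have "((\<lambda>t. t ^ 2 * (t + 80) ^ 3 / (32 - 5 * t) ^ 4) has_real_derivative
      ((2 * t * p ^ 3 + 3 * p ^ 2 * t ^ 2) * u ^ 4 - t ^ 2 * p ^ 3 * (- (20 * u ^ 3)))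
        / (u ^ 4 * u ^ 4)) (at t)"
    unfolding u_def p_def
    by (rule derivative_eq_intros refl)+ (use nz in \<open>simp_all add: u_def\<close>)
  moreover have "((2 * t * p ^ 3 + 3 * p ^ 2 * t ^ 2) * u ^ 4 - t ^ 2 * p ^ 3 * (- (20 * u ^ 3)))
        / (u ^ 4 * u ^ 4) = quintic' t"
  proof -
    \<comment> \<open>The factor \<open>t * p ^ 2 * u ^ 3\<close> reflects the zeros of order 2 and
      3 and the pole of order 4; what remains is the quadratic.\<close>
    have "(2 * t * p ^ 3 + 3 * p ^ 2 * t ^ 2) * u ^ 4 - t ^ 2 * p ^ 3 * (- (20 * u ^ 3))
        = ((2 * p + 3 * t) * u + 20 * t * p) * t * p ^ 2 * u ^ 3"
      by algebra
    also have "(2 * p + 3 * t) * u + 20 * t * p = 5 * (1024 + 192 * t - t ^ 2)"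
      unfolding u_def p_def by algebra
    finally have "(2 * t * p ^ 3 + 3 * p ^ 2 * t ^ 2) * u ^ 4 - t ^ 2 * p ^ 3 * (- (20 * u ^ 3))
        = 5 * (1024 + 192 * t - t ^ 2) * t * p ^ 2 * u ^ 3" .
    moreover have "X * u ^ 3 / (u ^ 4 * u ^ 4) = X / u ^ 5" for X
      using nz by (simp add: divide_simps flip: power_add)
    ultimately show ?thesis
      by (simp only: quintic'_def u_def p_def)
  qed
  ultimately show ?thesis
    unfolding quintic_def [abs_def] by (simp only:)
qed

text \<open>Compare the exponents of each factor. Those of \<open>t + 80\<close> and of the
  quadratic cancel: \<open>3 * (1/3 - 1) + 2 = 0\<close> and \<open>2 * (1/2 - 1) + 1 = 0\<close>.
  For \<open>t\<close> one gets \<open>2 * (1/3 - 1) + 1 = -1/3\<close>, for \<open>1 - t\<close>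
  just \<open>-1/2\<close>, and for \<open>32 - 5 * t\<close> the sum
  \<open>8/3 + 2 - 5 = -1/3\<close>. Pulling 32 out of the last factor leaves the constant
  \<open>32 powr (-1/3)\<close>.\<close>

lemma quintic_pullback:
  assumes t: "t \<in> {0..1}"
  shows "quintic t powr (1/3 - 1) * (1 - quintic t) powr (1/2 - 1) * quintic' t
    = 5 * 32 powr (-1/3) * (t powr (2/3 - 1) * (1 - t) powr (7/6 - 2/3 - 1)
        * (1 - 5/32 * t) powr (- (1/3)))"
proof (cases "t = 0 \<or> t = 1")
  case True
  \<comment> \<open>Both sides are the junk value 0 here, because \<open>0 powr a = 0\<close>.\<close>
  then show ?thesis
    by (auto simp: one_minus_quintic quintic'_def)
next
  case False
  with t have t: "0 < t" "t < 1" by auto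
  define u q p where "u = 32 - 5 * t" and "q = 1024 + 192 * t - t ^ 2" and "p = t + 80"
  have "t ^ 2 < 1" using t by (simp add: power_less_one_iff)
  then have pos: "u > 0" "q > 0" "p > 0"
    unfolding u_def q_def p_def using t by auto
  \<comment> \<open>With every factor written as an exponential, the identity becomes linear in the
    logarithms.\<close>
  have 1: "quintic t = exp (2 * ln t + 3 * ln p - 4 * ln u)"
    using t pos by (simp add: quintic_def u_def[symmetric] p_def[symmetric] exp_diff exp_add
        exp_of_nat_mult[of 2, simplified] exp_of_nat_mult[of 3, simplified]
        exp_of_nat_mult[of 4, simplified])
  have "1 - quintic t = (1 - t) * q ^ 2 / u ^ 4"
    using t by (simp add: one_minus_quintic u_def q_def)
  then have 2: "1 - quintic t = exp (ln (1 - t) + 2 * ln q - 4 * ln u)"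
    using t pos by (simp add: exp_diff exp_add exp_of_nat_mult[of 2, simplified]
        exp_of_nat_mult[of 4, simplified])
  have "quintic' t = 5 * q * t * p ^ 2 / u ^ 5"
    by (simp add: quintic'_def q_def u_def p_def)
  then have 3: "quintic' t = 5 * exp (ln q + ln t + 2 * ln p - 5 * ln u)"
    using t pos by (simp add: exp_diff exp_add exp_of_nat_mult[of 2, simplified]
        exp_of_nat_mult[of 5, simplified])
  have 4: "1 - 5/32 * t = exp (ln u - ln 32)"
    using pos by (simp add: exp_diff u_def)
  have "quintic t powr (1/3 - 1) * (1 - quintic t) powr (1/2 - 1) * quintic' t
      = 5 * exp ((1/3 - 1) * (2 * ln t + 3 * ln p - 4 * ln u)
         + (1/2 - 1) * (ln (1 - t) + 2 * ln q - 4 * ln u)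
         + (ln q + ln t + 2 * ln p - 5 * ln u))"
    \<comment> \<open>\<open>1\<close> comes after \<open>2\<close> because \<open>quintic t\<close>
      occurs inside \<open>1 - quintic t\<close>.\<close>
    unfolding 2 3 unfolding 1 exp_add by (simp add: powr_def)
  also have "\<dots> = 5 * exp ((-1/3) * ln 32 + (2/3 - 1) * ln t + (7/6 - 2/3 - 1) * ln (1 - t)
         + (- (1/3)) * (ln u - ln 32))"
    by (simp add: field_simps)
  also have "\<dots> = 5 * 32 powr (-1/3) * (t powr (2/3 - 1) * (1 - t) powr (7/6 - 2/3 - 1)
        * (1 - 5/32 * t) powr (- (1/3)))"
    unfolding 4 exp_add using t by (simp add: powr_def)
  finally show ?thesis .
qed

text \<open>Substitute \<open>s = quintic t\<close> in the integral for
  \<open>Beta (1/3) (1/2)\<close>; the derivative is nonnegative on the unit interval.\<close>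

lemma period_eq_Beta:
  "(\<integral>\<^sup>+t. ennreal (t powr (2/3 - 1) * (1 - t) powr (7/6 - 2/3 - 1) * (1 - 5/32 * t) powr (- (1/3)))
      * indicator {0..1} t \<partial>lborel) = ennreal (32 powr (1/3) / 5 * Beta (1/3) (1/2))"
proof -
  let ?w = "\<lambda>t::real. t powr (2/3 - 1) * (1 - t) powr (7/6 - 2/3 - 1) * (1 - 5/32 * t) powr (- (1/3))"
  let ?f = "\<lambda>s::real. s powr (1/3 - 1) * (1 - s) powr (1/2 - 1)"
  \<comment> \<open>The endpoints are fixed: \<open>quintic 0 = 0\<close>, and
    \<open>quintic 1 = 81 ^ 3 / 27 ^ 4 = 1\<close> since both powers are
    \<open>3 ^ 12\<close>.\<close>
  have "ennreal (Beta (1/3) (1/2)) = (\<integral>\<^sup>+s. ennreal (?f s) * indicator {quintic 0..quintic 1} s \<partial>lborel)"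
    by (simp add: quintic_def nn_integral_Beta_real[symmetric])
  also have "\<dots> = (\<integral>\<^sup>+t. ennreal (?f (quintic t) * quintic' t) * indicator {0..1} t \<partial>lborel)"
  proof -
    have "set_borel_measurable borel {quintic 0..quintic 1} ?f"
      unfolding set_borel_measurable_def by measurable
    moreover have "continuous_on {0..1} quintic'"
      unfolding quintic'_def [abs_def] by (intro continuous_intros) auto
    moreover have "quintic' t \<ge> 0" if t: "t \<in> {0..1}" for t
    proof -
      have "t ^ 2 \<le> t" using t by (simp add: power2_eq_square mult_left_le)
      then have "1024 + 192 * t - t ^ 2 \<ge> 0" using t by simp
      then show ?thesis
        unfolding quintic'_def using t
        by (intro divide_nonneg_nonneg mult_nonneg_nonneg) auto
    qed
    ultimately have "(\<integral>\<^sup>+s. ennreal (?f s * indicator {quintic 0..quintic 1} s) \<partial>lborel)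
       = (\<integral>\<^sup>+t. ennreal (?f (quintic t) * quintic' t * indicator {0..1} t) \<partial>lborel)"
      by (intro nn_integral_substitution) (auto intro: quintic_has_derivative)
    then show ?thesis
      by (simp add: ennreal_mult'' ennreal_indicator)
  qed
  also have "\<dots> = (\<integral>\<^sup>+t. ennreal (5 * 32 powr (-1/3)) * (ennreal (?w t) * indicator {0..1} t) \<partial>lborel)"
  proof (rule nn_integral_cong)
    fix t :: real
    show "ennreal (?f (quintic t) * quintic' t) * indicator {0..1} t
        = ennreal (5 * 32 powr (-1/3)) * (ennreal (?w t) * indicator {0..1} t)"
    proof (cases "t \<in> {0..1}")
      case True
      then show ?thesis
        by (simp only: quintic_pullback) (subst ennreal_mult', auto simp: mult.assoc)
    qed simp
  qed
  also have "\<dots> = ennreal (5 * 32 powr (-1/3)) * (\<integral>\<^sup>+t. ennreal (?w t) * indicator {0..1} t \<partial>lborel)"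
    by (rule nn_integral_cmult) measurable
  finally have eq: "ennreal (Beta (1/3) (1/2)) = \<dots>" .
  have "ennreal (32 powr (1/3) / 5) * ennreal (5 * 32 powr (-1/3)) = 1"
    by (simp add: ennreal_mult'[symmetric] powr_minus[of 32 "1/3", simplified])
  moreover have "ennreal (32 powr (1/3) / 5 * Beta (1/3) (1/2))
      = ennreal (32 powr (1/3) / 5) * ennreal (Beta (1/3) (1/2))"
    by (rule ennreal_mult') simp
  ultimately show ?thesis
    by (simp only: eq mult.assoc[symmetric] mult_1_left)
qed

section \<open>Reduction of the Gamma values to \<open>Gamma (1/3)\<close>\<close>

lemma Gamma_reflection_real:
  fixes z :: real
  shows "Gamma z * Gamma (1 - z) = pi / sin (pi * z)"
proof -
  have "complex_of_real (Gamma z * Gamma (1 - z)) = of_real (pi / sin (pi * z))"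
    using Gamma_reflection_complex[of "of_real z"] Gamma_complex_of_real[of z]
      Gamma_complex_of_real[of "1 - z"] sin_of_real[where 'a = complex, of "pi * z"]
    by simp
  then show ?thesis by (simp only: of_real_eq_iff)
qed

lemma Gamma_legendre_duplication_real:
  fixes z :: real
  assumes "z > 0"
  shows "Gamma z * Gamma (z + 1/2) = 2 powr (1 - 2 * z) * sqrt pi * Gamma (2 * z)"
proof -
  have "Gamma (complex_of_real z) * Gamma (complex_of_real z + 1/2)
     = exp ((1 - 2 * complex_of_real z) * of_real (ln 2)) * of_real (sqrt pi) * Gamma (2 * of_real z)"
    using assms by (intro Gamma_legendre_duplication)
      (auto elim!: nonpos_Ints_cases simp: complex_eq_iff)
  also have "exp ((1 - 2 * complex_of_real z) * of_real (ln 2)) = of_real (2 powr (1 - 2 * z))"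
    by (simp add: powr_def flip: exp_of_real)
  also have "complex_of_real z + 1/2 = of_real (z + 1/2)" by simp
  also have "2 * complex_of_real z = of_real (2 * z)" by simp
  finally show ?thesis
    unfolding Gamma_complex_of_real by (simp only: of_real_eq_iff flip: of_real_mult)
qed

text \<open>The quotient involves Gamma at 1/3, 2/3, 5/6 and 7/6. The recurrence replaces 7/6 by
  1/6; reflection at 1/3 and 1/6 and duplication at 1/6 then express everything through
  \<open>Gamma (1/3)\<close> and \<open>pi\<close>.\<close>

lemma Beta_quotient_eq:
  "32 powr (1/3) / 5 * Beta (1/3) (1/2) / Beta (2/3) (7/6 - 2/3)
    = 1 / 20 * (sqrt 3 * Gamma (1/3 :: real) ^ 6 / pi ^ 3)"
proof -
  define g h k l :: real
    where "g = Gamma (1/3)" and "h = Gamma (2/3)" and "k = Gamma (1/6)" and "l = Gamma (5/6)"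
  have pos: "g > 0" "h > 0" "k > 0" "l > 0"
    unfolding g_def h_def k_def l_def by (auto intro!: Gamma_real_pos)
  have gh: "g * h = 2 * pi / sqrt 3"
    using Gamma_reflection_real[of "1/3"] by (simp add: g_def h_def sin_60)
  have kl: "k * l = 2 * pi"
    using Gamma_reflection_real[of "1/6"] by (simp add: k_def l_def sin_30)
  have kh: "k * h = 2 powr (2/3) * sqrt pi * g"
    using Gamma_legendre_duplication_real[of "1/6"] by (simp add: k_def h_def g_def)
  have k7: "Gamma (7/6) = k / 6"
  proof -
    have "(1/6 :: real) \<notin> \<int>\<^sub>\<le>\<^sub>0"
      by (auto dest!: nonpos_Ints_nonpos)
    from Gamma_plus1[OF this] show ?thesis by (simp add: k_def)
  qed
  have two: "32 powr (1/3) * (2 powr (2/3)) ^ 2 = (8 :: real)"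
  proof -
    have "32 powr (1/3) = 2 powr (5/3 :: real)"
      using powr_powr[of "2::real" 5 "1/3"] by simp
    then show ?thesis
      by (simp add: power2_eq_square flip: powr_add)
  qed
  have "32 powr (1/3) / 5 * Beta (1/3) (1/2) / Beta (2/3) (7/6 - 2/3)
      = 32 powr (1/3) / 5 * (g * (k / 6) / (l * h))"
    using pos by (simp add: Beta_def k7 g_def h_def l_def Gamma_one_half_real)
  \<comment> \<open>Extending the fraction by \<open>k * h ^ 2\<close> makes \<open>k\<close> and
    \<open>l\<close> occur only in the known products \<open>k * h\<close> and
    \<open>k * l\<close>.\<close>
  also have "\<dots> = 32 powr (1/3) * g * (k * h) ^ 2 / (30 * (k * l) * h ^ 3)"
    using pos by (simp add: field_simps power2_eq_square power3_eq_cube)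
  also have "\<dots> = (32 powr (1/3) * (2 powr (2/3)) ^ 2) * pi * g ^ 3 / (60 * pi * h ^ 3)"
    unfolding kh kl power_mult_distrib real_sqrt_pow2[OF pi_ge_zero] by (simp add: power2_eq_square power3_eq_cube mult_ac)
  \<comment> \<open>Extending by \<open>g ^ 3\<close> turns the remaining \<open>h ^ 3\<close> into
    the known product \<open>g * h\<close>.\<close>
  also have "\<dots> = 2 / 15 * g ^ 6 / (g * h) ^ 3"
    unfolding two using pos by (simp add: field_simps flip: power_add)
  also have "\<dots> = 1 / 20 * (sqrt 3 * g ^ 6 / pi ^ 3)"
    unfolding gh by (simp add: power_divide power_mult_distrib power3_eq_cube field_simps)
  finally show ?thesis unfolding g_def .
qed

theorem mainTheorem16:
  shows "hyp2F1 (1/3) (2/3) (7/6) (5/32) =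
    complex_of_real (1 / 20 * (sqrt 3 * Gamma (1/3 :: real) ^ 6 / pi ^ 3))"
proof -
  have "Beta (1/3) (1/2) > (0 :: real)"
    by (simp add: Beta_def Gamma_real_pos)
  then have "hyp2F1 (of_real (1/3)) (of_real (2/3)) (of_real (7/6)) (of_real (5/32))
      = of_real (32 powr (1/3) / 5 * Beta (1/3) (1/2) / Beta (2/3) (7/6 - 2/3))"
    by (intro hyp2F1_eq_if_Euler_integral period_eq_Beta) auto
  then show ?thesis
    unfolding Beta_quotient_eq by simp
qed

end
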